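(* Let $q,r>0$ be real, let $\mathcal{L}_n(x)=\mathcal{L}_n(x;q,r)$ for $n\in\mathbb{Z}_+$, and put $\mathcal{L}_{-2}(x)=\mathcal{L}_{-1}(x)=0$. Then for every $n\in\mathbb{Z}_+$, identically in $x$, $$\begin{aligned}&(n-1)n\,\mathcal{L}_{n-2}(x)-n(3n+q+r-2)\,\mathcal{L}_{n-1}(x)+\bigl(n(2n+q+r-1)+(n+q)(n+r)\bigr)\mathcal{L}_n(x)\\&\quad-(n+q)(n+r)\,\mathcal{L}_{n+1}(x)+n\,x\,\mathcal{L}_{n-1}(x)-(n+1)\,x\,\mathcal{L}_n(x)=0.\end{aligned}$$
   Context: $\mathbb{Z}_+$ is the set of non-negative integers. The shifted factorial is $(u)_0=1$, $(u)_k=u(u+1)\cdots(u+k-1)$ for $k\geq 1$. For $q,r>0$ and $n\in\mathbb{Z}_+$, $$\mathcal{L}_n(x;q,r)={}_2F_2(-n,1;q,r;x)=\sum_{k=0}^{n}\frac{(-n)_k(1)_k}{(q)_k(r)_k}\frac{x^k}{k!}.$$ *)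

theory Defs
  imports Complex_Main
begin

text \<open>
  The polynomial \<open>\<L>\<^sub>n(x;q,r) = \<^sub>2F\<^sub>2(-n,1;q,r;x)\<close>; the series stops at \<open>k = n\<close> because
  \<open>(-n)\<^sub>k = 0\<close> for \<open>k > n\<close>. The parameters are real; the argument lives in any field over the
  reals, in particular it may be real or complex.
\<close>
definition calL :: "real \<Rightarrow> real \<Rightarrow> nat \<Rightarrow> 'a::real_field \<Rightarrow> 'a" where
  "calL q r n x =
    (\<Sum>k=0..n. (pochhammer (- real n) k * pochhammer 1 k / (pochhammer q k * pochhammer r k))
                 *\<^sub>R (x ^ k / fact k))"

text \<open>Extension to integer indices, with value zero at the negative ones.\<close>
definition calLZ :: "real \<Rightarrow> real \<Rightarrow> int \<Rightarrow> 'a::real_field \<Rightarrow> 'a" where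
  "calLZ q r m x = (if m < 0 then 0 else calL q r (nat m) x)"

end

theory Submission
  imports Defs
begin

text \<open>
  The identity is a comparison of coefficients, in which every term is expressed through
  \<open>\<L>\<^sub>n\<close> and \<open>\<L>\<^sub>n\<^sub>+\<^sub>1\<close>. Write \<open>\<theta> = x d/dx\<close>, which multiplies \<open>x\<^sup>k\<close> by \<open>k\<close>. Since
  \<open>m (1-m)\<^sub>k = (m-k) (-m)\<^sub>k\<close>, lowering the index is the first-order operator
  \<open>m \<L>\<^sub>m\<^sub>-\<^sub>1 = (m-\<theta>) \<L>\<^sub>m\<close>; applied twice it gives
  \<open>n(n-1) \<L>\<^sub>n\<^sub>-\<^sub>2 = (n-\<theta>)(n-1-\<theta>) \<L>\<^sub>n\<close>. Multiplication by \<open>x\<close> shifts the coefficients, and the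
  particular combination that occurs satisfies
  \<open>x (n \<L>\<^sub>n\<^sub>-\<^sub>1 - (n+1) \<L>\<^sub>n) = (\<theta>+q-1)(\<theta>+r-1)(\<L>\<^sub>n\<^sub>+\<^sub>1 - \<L>\<^sub>n)\<close>.

  After these substitutions \<open>\<L>\<^sub>n\<^sub>+\<^sub>1\<close> carries the factor
  \<open>(\<theta>+q-1)(\<theta>+r-1) - (n+q)(n+r) = -(n+1-\<theta>)(n+q+r-1+\<theta>)\<close>, and the lowering relation
  \<open>(n+1-\<theta>) \<L>\<^sub>n\<^sub>+\<^sub>1 = (n+1) \<L>\<^sub>n\<close> turns its contribution into one of \<open>\<L>\<^sub>n\<close>. What remains is a
  polynomial in \<open>\<theta>\<close> acting on \<open>\<L>\<^sub>n\<close>, and that polynomial is zero. The lemmas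
  \<open>calLcoeff_lower\<close>, \<open>x_mult_calL_difference\<close> and \<open>calLcoeff_recurrence\<close> carry out these three steps.
\<close>

definition calLcoeff :: "real \<Rightarrow> real \<Rightarrow> nat \<Rightarrow> nat \<Rightarrow> real" where
  "calLcoeff q r m k = pochhammer (- real m) k / (pochhammer q k * pochhammer r k)"

lemma calLcoeff_eq_0: "m < k \<Longrightarrow> calLcoeff q r m k = 0"
  by (simp add: calLcoeff_def pochhammer_of_nat_eq_0_lemma)

text \<open>
  Coefficients beyond the degree vanish, so polynomials of different degrees can be summed over a
  common range of exponents.
\<close>
lemma calL_eq_sum_calLcoeff:
  fixes x :: "'a::real_field"
  assumes "m \<le> N"
  shows "calL q r m x = (\<Sum>k\<le>N. calLcoeff q r m k *\<^sub>R x ^ k)"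
proof -
  have "calL q r m x = (\<Sum>k\<le>m. calLcoeff q r m k *\<^sub>R x ^ k)"
    unfolding calL_def calLcoeff_def atLeast0AtMost
    by (intro sum.cong refl)
       (simp add: pochhammer_fact [symmetric] scaleR_conv_of_real field_simps)
  also have "\<dots> = (\<Sum>k\<le>N. calLcoeff q r m k *\<^sub>R x ^ k)"
    using assms
    by (intro sum.mono_neutral_left) (auto simp: calLcoeff_eq_0)
  finally show ?thesis .
qed

text \<open>
  Both sides of \<open>u (1-u)\<^sub>k = (u-k) (-u)\<^sub>k\<close> equal \<open>-(-u)\<^sub>k\<^sub>+\<^sub>1\<close>: one splits off the first factor,
  the other the last.
\<close>
lemma pochhammer_uminus_lower:
  fixes u :: "'a::comm_ring_1"
  shows "u * pochhammer (1 - u) k = (u - of_nat k) * pochhammer (- u) k"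
proof -
  have "- u * pochhammer (1 - u) k = pochhammer (- u) (Suc k)"
    by (simp add: pochhammer_rec)
  also have "\<dots> = - ((u - of_nat k) * pochhammer (- u) k)"
    by (simp add: pochhammer_Suc algebra_simps)
  finally show ?thesis by simp
qed

lemma calLcoeff_lower:
  "(real m + 1) * calLcoeff q r m k = (real m + 1 - real k) * calLcoeff q r (Suc m) k"
  using pochhammer_uminus_lower [of "real (Suc m)" k]
  by (simp add: calLcoeff_def add.commute)

text \<open>
  The factor \<open>n\<close> annihilates the term with a negative index, so the lowering relation holds for
  \<open>n = 0\<close> as well.
\<close>
lemma calLZ_pred:
  fixes x :: "'a::real_field"
  assumes "n \<le> N"
  shows "real n *\<^sub>R calLZ q r (int n - 1) x
       = (\<Sum>k\<le>N. ((real n - real k) * calLcoeff q r n k) *\<^sub>R x ^ k)"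
    (is "_ = ?sum")
proof (cases n)
  case 0
  have "(real n - real k) * calLcoeff q r n k = 0" for k
    using 0 by (cases k) (simp_all add: calLcoeff_eq_0)
  then have "?sum = 0" by (simp only: scaleR_zero_left sum.neutral_const)
  with 0 show ?thesis by simp
next
  case (Suc m)
  then have "calLZ q r (int n - 1) x = calL q r m x"
    by (simp add: calLZ_def)
  moreover have "m \<le> N" using Suc assms by simp
  ultimately have "real n *\<^sub>R calLZ q r (int n - 1) x
      = (\<Sum>k\<le>N. ((real m + 1) * calLcoeff q r m k) *\<^sub>R x ^ k)"
    using Suc by (simp add: calL_eq_sum_calLcoeff scaleR_sum_right add.commute)
  then show ?thesis
    unfolding calLcoeff_lower using Suc by (simp add: add.commute)
qed

lemma calLZ_pred_pred:
  fixes x :: "'a::real_field"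
  assumes "n \<le> N"
  shows "((real n - 1) * real n) *\<^sub>R calLZ q r (int n - 2) x
       = (\<Sum>k\<le>N. ((real n - real k) * (real n - 1 - real k) * calLcoeff q r n k) *\<^sub>R x ^ k)"
    (is "_ = ?sum")
proof (cases n)
  case 0
  have "(real n - real k) * (real n - 1 - real k) * calLcoeff q r n k = 0" for k
    using 0 by (cases k) (simp_all add: calLcoeff_eq_0)
  then have "?sum = 0" by (simp only: scaleR_zero_left sum.neutral_const)
  with 0 show ?thesis by simp
next
  case (Suc m)
  have "((real n - 1) * real n) *\<^sub>R calLZ q r (int n - 2) x
      = (real m + 1) *\<^sub>R (real m *\<^sub>R calLZ q r (int m - 1) x)"
    using Suc by (simp add: algebra_simps)
  also have "\<dots> = (\<Sum>k\<le>N. ((real m - real k) * ((real m + 1) * calLcoeff q r m k)) *\<^sub>R x ^ k)"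
    using Suc assms
    by (simp add: calLZ_pred [of m N] scaleR_sum_right mult.left_commute)
  finally show ?thesis
    unfolding calLcoeff_lower using Suc by (simp add: mult_ac add.commute)
qed

text \<open>
  The shift of exponents replaces \<open>1/((q)\<^sub>k(r)\<^sub>k)\<close> by \<open>(q+k)(r+k)/((q)\<^sub>k\<^sub>+\<^sub>1(r)\<^sub>k\<^sub>+\<^sub>1)\<close>; positivity of
  the parameters excludes a zero denominator.
\<close>
lemma calLcoeff_shift:
  assumes "q > 0" and "r > 0"
  shows "(q + real k) * (r + real k) * (calLcoeff q r (Suc n) (Suc k) - calLcoeff q r n (Suc k))
       = (real n - real k) * calLcoeff q r n k - (real n + 1) * calLcoeff q r n k"
proof -
  have pos: "pochhammer q k > 0" "pochhammer r k > 0" "q + real k > 0" "r + real k > 0"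
    using assms by (simp_all add: pochhammer_pos)
  \<comment> \<open>Split off the first factor of \<open>(-n-1)\<^sub>k\<^sub>+\<^sub>1\<close> and the last factor of \<open>(-n)\<^sub>k\<^sub>+\<^sub>1\<close>, so that both
      become multiples of \<open>(-n)\<^sub>k\<close>.\<close>
  have raise: "pochhammer (- real (Suc n)) (Suc k) = - (real n + 1) * pochhammer (- real n) k"
    by (simp add: pochhammer_rec)
  have same: "pochhammer (- real n) (Suc k) = (real k - real n) * pochhammer (- real n) k"
    by (simp add: pochhammer_Suc algebra_simps)
  have cancel: "a * b * (P / (s * a * (t * b)) - P' / (s * a * (t * b))) = (P - P') / (s * t)"
    if "a > 0" "b > 0" "s > 0" "t > 0" for a b s t P P' :: real
    using that by (simp add: field_simps)
  show ?thesis
    unfolding calLcoeff_def raise same pochhammer_Suc [of q] pochhammer_Suc [of r]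
      cancel [OF pos(3,4,1,2)]
    by (simp add: field_simps diff_divide_distrib [symmetric] add_divide_distrib [symmetric])
qed

lemma x_mult_calL_difference:
  fixes x :: "'a::real_field"
  assumes "q > 0" and "r > 0"
  shows "real n *\<^sub>R (x * calLZ q r (int n - 1) x) - (real n + 1) *\<^sub>R (x * calL q r n x)
       = (\<Sum>k\<le>Suc n. ((q + real k - 1) * (r + real k - 1)
            * (calLcoeff q r (Suc n) k - calLcoeff q r n k)) *\<^sub>R x ^ k)"
    (is "_ = (\<Sum>k\<le>Suc n. ?d k *\<^sub>R x ^ k)")
proof -
  have "real n *\<^sub>R (x * calLZ q r (int n - 1) x) - (real n + 1) *\<^sub>R (x * calL q r n x)
      = x * (real n *\<^sub>R calLZ q r (int n - 1) x - (real n + 1) *\<^sub>R calL q r n x)"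
    by (simp add: right_diff_distrib)
  also have "\<dots> = x * (\<Sum>k\<le>n. ((real n - real k) * calLcoeff q r n k
                              - (real n + 1) * calLcoeff q r n k) *\<^sub>R x ^ k)"
    by (simp only: calLZ_pred [OF order_refl] calL_eq_sum_calLcoeff [OF order_refl]
          scaleR_sum_right scaleR_scaleR scaleR_left_diff_distrib sum_subtractf)
  also have "\<dots> = (\<Sum>k\<le>n. ?d (Suc k) *\<^sub>R x ^ Suc k)"
    by (simp add: calLcoeff_shift [OF assms, symmetric] sum_distrib_left)
  also have "\<dots> = (\<Sum>k\<le>Suc n. ?d k *\<^sub>R x ^ k)"
    \<comment> \<open>The constant terms of \<open>\<L>\<^sub>n\<^sub>+\<^sub>1\<close> and \<open>\<L>\<^sub>n\<close> agree, so the difference has none.\<close>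
    unfolding sum.atMost_Suc_shift by (simp add: calLcoeff_def)
  finally show ?thesis .
qed

lemma calLcoeff_recurrence:
  "(real n - real k) * (real n - 1 - real k) * calLcoeff q r n k
   - (3 * real n + q + r - 2) * ((real n - real k) * calLcoeff q r n k)
   + (real n * (2 * real n + q + r - 1) + (real n + q) * (real n + r)) * calLcoeff q r n k
   - (real n + q) * (real n + r) * calLcoeff q r (Suc n) k
   + (q + real k - 1) * (r + real k - 1) * (calLcoeff q r (Suc n) k - calLcoeff q r n k) = 0"
  (is "?lhs = 0")
proof -
  \<comment> \<open>The multiplier is the cofactor of \<open>n+1-k\<close> in \<open>(n+q)(n+r) - (q+k-1)(r+k-1)\<close>.\<close>
  have "?lhs = (real n + q + r + real k - 1)
      * ((real n + 1) * calLcoeff q r n k - (real n + 1 - real k) * calLcoeff q r (Suc n) k)"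
    by algebra
  then show ?thesis by (simp add: calLcoeff_lower)
qed

theorem theorem6:
  fixes q r :: real and n :: nat and x :: "'a::real_field"
  assumes "q > 0" and "r > 0"
  defines "L \<equiv> (\<lambda>m::int. calLZ q r m x)"
  shows
    "((real n - 1) * real n) *\<^sub>R L (int n - 2)
     - (real n * (3 * real n + q + r - 2)) *\<^sub>R L (int n - 1)
     + (real n * (2 * real n + q + r - 1) + (real n + q) * (real n + r)) *\<^sub>R L (int n)
     - ((real n + q) * (real n + r)) *\<^sub>R L (int n + 1)
     + real n *\<^sub>R (x * L (int n - 1))
     - (real n + 1) *\<^sub>R (x * L (int n)) = 0"
proof -
  have n: "n \<le> Suc n" by simp
  have L_n: "L (int n) = calL q r n x"
    by (simp add: L_def calLZ_def)
  have L_Suc: "L (int n + 1) = calL q r (Suc n) x"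
    by (simp add: L_def calLZ_def nat_add_distrib)
  have L_pred: "(real n * c) *\<^sub>R L (int n - 1)
      = (\<Sum>k\<le>Suc n. (c * ((real n - real k) * calLcoeff q r n k)) *\<^sub>R x ^ k)" for c
    using arg_cong [OF calLZ_pred [OF n, of q r x], of "(*\<^sub>R) c"]
    by (simp only: L_def scaleR_sum_right scaleR_scaleR mult.commute [of c "real n"])
  have "((real n - 1) * real n) *\<^sub>R L (int n - 2)
     - (real n * (3 * real n + q + r - 2)) *\<^sub>R L (int n - 1)
     + (real n * (2 * real n + q + r - 1) + (real n + q) * (real n + r)) *\<^sub>R L (int n)
     - ((real n + q) * (real n + r)) *\<^sub>R L (int n + 1)
     + (real n *\<^sub>R (x * L (int n - 1)) - (real n + 1) *\<^sub>R (x * L (int n)))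
    = (\<Sum>k\<le>Suc n. ((real n - real k) * (real n - 1 - real k) * calLcoeff q r n k
       - (3 * real n + q + r - 2) * ((real n - real k) * calLcoeff q r n k)
       + (real n * (2 * real n + q + r - 1) + (real n + q) * (real n + r)) * calLcoeff q r n k
       - (real n + q) * (real n + r) * calLcoeff q r (Suc n) k
       + (q + real k - 1) * (r + real k - 1)
           * (calLcoeff q r (Suc n) k - calLcoeff q r n k)) *\<^sub>R x ^ k)"
    unfolding L_pred L_n L_Suc
    unfolding L_def calLZ_pred_pred [OF n] x_mult_calL_difference [OF assms(1,2)]
    unfolding calL_eq_sum_calLcoeff [OF n] calL_eq_sum_calLcoeff [OF order_refl, of q r "Suc n"]
    by (simp only: scaleR_sum_right scaleR_scaleR scaleR_left_distrib scaleR_left_diff_distrib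
          sum.distrib sum_subtractf)
  also have "\<dots> = 0"
    by (simp only: calLcoeff_recurrence scaleR_zero_left sum.neutral_const)
  finally show ?thesis by (simp only: add_diff_eq)
qed

end
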